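(* Let $F\subseteq M(A)$ be a collection of mappings on a nonempty set $A$. Then the following are equivalent: 1. $F$ is a Toffoli algebra. 2. $F$ is closed under $\{i_1,\oplus,\tau,\zeta\}\cup\{\circ_k\mid k\in\mathbb N\}$. 3. $F$ is closed under $\{\oplus\}\cup\{\pi_\alpha\mid\alpha\in S_{(\mathbb N)}\}\cup\{\circ_k\mid k\in\mathbb N\}$. 4. $F$ is closed under $\{i_1,\oplus,\tau,\zeta,\bullet\}$.
   Context: $\mathbb N=\{1,2,3,\dots\}$. For a nonempty set $A$ and $n,m\in\mathbb N$, $M_{n,m}(A)$ is the set of all maps $f:A^n\to A^m$ (arity $n$, co-arity $m$), $M(A)=\bigcup_{n,m}M_{n,m}(A)$, and $f=(f_1,\dots,f_m)$ in components. $S_n$ is the set of permutations of $\{1,\dots,n\}$ and $S_{(\mathbb N)}=\bigcup_{n\in\mathbb N}S_n$. Operations on $M(A)$, for $f\in M_{n,s}(A)$, $g\in M_{m,t}(A)$: - $i_1:A\to A$ is the identity (a constant, i.e. nullary operation); - $f\oplus g\in M_{n+m,s+t}(A)$, $(f\oplus g)(x_1,\dots,x_{n+m})=(f_1(x_1,\dots,x_n),\dots,f_s(x_1,\dots,x_n),g_1(x_{n+1},\dots,x_{n+m}),\dots,g_t(x_{n+1},\dots,x_{n+m}))$; - for $k\in\mathbb N$ with $k\le n$ and $k\le t$ (otherwise undefined), $f\circ_k g\in M_{n+m-k,s+t-k}(A)$ has $j$-th component, for $j\le s$, $f_j(g_1(x_1,\dots,x_m),\dots,g_k(x_1,\dots,x_m),x_{m+1},\dots,x_{m+n-k})$,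 and, for $s<j\le s+t-k$, $g_{k+j-s}(x_1,\dots,x_m)$; - $f\bullet g=f\circ_k g$ with $k=\min(n,t)$, i.e. the minimum of the arity of $f$ and the co-arity of $g$ (a total operation); - $(\tau f)(x_1,\dots,x_n)=f(x_2,x_1,x_3,\dots,x_n)$, $(\zeta f)(x_1,\dots,x_n)=f(x_2,\dots,x_n,x_1)$, with $\tau f=\zeta f=f$ if $n=1$; - for $\alpha\in S_n$, $\pi_\alpha\in M_{n,n}(A)$ is the map $\pi_\alpha(x_1,\dots,x_n)=(x_{\alpha^{-1}(1)},\dots,x_{\alpha^{-1}(n)})$ (a nullary operation). Closed under a nullary operation means containing that map; closed under a partial operation means containing its value whenever it is defined on elements of $F$. A Toffoli algebra on $A$ is a subset of $M(A)$ closed under $\{i_1,\oplus,\tau,\zeta\}$ and the partial operations $\{\circ_k\mid k\in\mathbb N\}$. *)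

theory Defs
  imports Main "HOL-Library.FuncSet" "HOL-Library.NList" "HOL-Combinatorics.Permutations"
begin

text \<open>
  A tuple \<open>(x\<^sub>1, \<dots>, x\<^sub>n)\<close> is a list, with \<open>x\<^sub>j\<close> stored at position \<open>j - 1\<close>, and \<open>A\<^sup>n\<close> is
  \<open>nlists n A\<close>.  A map \<open>A\<^sup>n \<rightarrow> A\<^sup>m\<close> carries its arity and co-arity, and its underlying function is
  \<open>undefined\<close> outside \<open>A\<^sup>n\<close>, so that equality in \<open>maps A\<close> is equality of maps.
\<close>

datatype 'a mapping = Mapping (arity: nat) (coarity: nat) (app: "'a list \<Rightarrow> 'a list")

definition maps_of :: "'a set \<Rightarrow> nat \<Rightarrow> nat \<Rightarrow> 'a mapping set" where
  "maps_of A n m = {Mapping n m h | h. h \<in> nlists n A \<rightarrow>\<^sub>E nlists m A}"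

definition maps :: "'a set \<Rightarrow> 'a mapping set" where
  "maps A = (\<Union>n\<in>{1..}. \<Union>m\<in>{1..}. maps_of A n m)"

definition id_map :: "'a set \<Rightarrow> 'a mapping" where
  "id_map A = Mapping 1 1 (\<lambda>x\<in>nlists 1 A. x)"

definition oplus :: "'a set \<Rightarrow> 'a mapping \<Rightarrow> 'a mapping \<Rightarrow> 'a mapping" where
  "oplus A f g = Mapping (arity f + arity g) (coarity f + coarity g)
     (\<lambda>x\<in>nlists (arity f + arity g) A. app f (take (arity f) x) @ app g (drop (arity f) x))"

text \<open>The partial operation \<open>\<circ>\<^sub>k\<close>; the value \<open>None\<close> means that it is undefined.\<close>

definition comp_at :: "'a set \<Rightarrow> nat \<Rightarrow> 'a mapping \<Rightarrow> 'a mapping \<Rightarrow> 'a mapping option" where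
  "comp_at A k f g =
     (if 1 \<le> k \<and> k \<le> arity f \<and> k \<le> coarity g
      then Some (Mapping (arity f + arity g - k) (coarity f + coarity g - k)
        (\<lambda>x\<in>nlists (arity f + arity g - k) A.
           let y = app g (take (arity g) x)
           in app f (take k y @ drop (arity g) x) @ drop k y))
      else None)"

text \<open>On \<open>maps A\<close> the index below is at least 1, so the composition is always defined there.\<close>

definition bullet :: "'a set \<Rightarrow> 'a mapping \<Rightarrow> 'a mapping \<Rightarrow> 'a mapping" where
  "bullet A f g = the (comp_at A (min (arity f) (coarity g)) f g)"

definition tau :: "'a set \<Rightarrow> 'a mapping \<Rightarrow> 'a mapping" where
  "tau A f =
     (if arity f = 1 then f
      else Mapping (arity f) (coarity f)
        (\<lambda>x\<in>nlists (arity f) A. app f (x ! 1 # x ! 0 # drop 2 x)))"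

definition zeta :: "'a set \<Rightarrow> 'a mapping \<Rightarrow> 'a mapping" where
  "zeta A f =
     (if arity f = 1 then f
      else Mapping (arity f) (coarity f)
        (\<lambda>x\<in>nlists (arity f) A. app f (tl x @ [hd x])))"

text \<open>
  The degree \<open>n\<close> is an explicit argument because a function \<open>\<alpha>\<close> with \<open>\<alpha> permutes {1..n}\<close> does
  not determine it.
\<close>

definition perm_map :: "'a set \<Rightarrow> nat \<Rightarrow> (nat \<Rightarrow> nat) \<Rightarrow> 'a mapping" where
  "perm_map A n \<alpha> = Mapping n n (\<lambda>x\<in>nlists n A. map (\<lambda>i. x ! (inv \<alpha> i - 1)) [1..<Suc n])"

definition closed_nullary :: "'b set \<Rightarrow> 'b \<Rightarrow> bool" where
  "closed_nullary F c \<longleftrightarrow> c \<in> F"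

definition closed_unary :: "'b set \<Rightarrow> ('b \<Rightarrow> 'b) \<Rightarrow> bool" where
  "closed_unary F u \<longleftrightarrow> (\<forall>f\<in>F. u f \<in> F)"

definition closed_binary :: "'b set \<Rightarrow> ('b \<Rightarrow> 'b \<Rightarrow> 'b) \<Rightarrow> bool" where
  "closed_binary F b \<longleftrightarrow> (\<forall>f\<in>F. \<forall>g\<in>F. b f g \<in> F)"

definition closed_partial_binary :: "'b set \<Rightarrow> ('b \<Rightarrow> 'b \<Rightarrow> 'b option) \<Rightarrow> bool" where
  "closed_partial_binary F b \<longleftrightarrow> (\<forall>f\<in>F. \<forall>g\<in>F. \<forall>h. b f g = Some h \<longrightarrow> h \<in> F)"

definition toffoli_algebra :: "'a set \<Rightarrow> 'a mapping set \<Rightarrow> bool" where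
  "toffoli_algebra A F \<longleftrightarrow>
     F \<subseteq> maps A \<and>
     closed_nullary F (id_map A) \<and>
     closed_binary F (oplus A) \<and>
     closed_unary F (tau A) \<and>
     closed_unary F (zeta A) \<and>
     (\<forall>k\<ge>1. closed_partial_binary F (comp_at A k))"

end

theory Submission
  imports Defs
begin

text \<open>
  The three lists of operations differ only in how they provide rearrangements of the inputs of a
  map.  Write \<open>f\<^sup>\<sigma>\<close> for \<open>f\<close> with its inputs rearranged by a permutation \<open>\<sigma>\<close> of the positions
  \<open>0, \<dots>, n - 1\<close> (this is \<open>reindex\<close> below).  For \<open>n \<ge> 2\<close>, \<open>\<tau> f\<close> and \<open>\<zeta> f\<close> are the cases where \<open>\<sigma>\<close>
  is the transposition of the first two positions and the \<open>n\<close>-cycle; for \<open>n = 1\<close> both are \<open>f\<close>.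

  Since these two generate the symmetric group and \<open>\<sigma> \<mapsto> f\<^sup>\<sigma>\<close> turns composition of permutations into
  iterated rearrangement, a set closed under \<open>\<tau>\<close> and \<open>\<zeta>\<close> is closed under all rearrangements
  (\<open>closed_reindex\<close>).  Together with the identities of every arity, which are sums of copies
  of \<open>i\<^sub>1\<close>, this yields every \<open>\<pi>\<^sub>\<alpha>\<close>.  Conversely \<open>\<pi>\<^sub>\<alpha>\<close> is a rearranged identity, and
  \<open>f\<^sup>\<sigma> = f \<circ>\<^sub>n \<pi>\<^sub>\<alpha>\<close> for a suitable \<open>\<alpha>\<close>, so that \<open>\<tau>\<close> and \<open>\<zeta>\<close> come from the maps \<open>\<pi>\<^sub>\<alpha>\<close> and the full
  composition.

  As \<open>\<bullet>\<close> is always one of the \<open>\<circ>\<^sub>k\<close>, it remains to recover \<open>f \<circ>\<^sub>k g\<close> from \<open>\<bullet>\<close>.  If \<open>k\<close> is the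
  co-arity \<open>t\<close> of \<open>g\<close> there is nothing to do.  Otherwise the outputs \<open>k + 1, \<dots>, t\<close> of \<open>g\<close> have to
  bypass \<open>f\<close>; this is achieved by adding \<open>t - k\<close> identity wires to \<open>f\<close>, rearranging the inputs so
  that all outputs of \<open>g\<close> are consumed first, and composing with \<open>\<bullet>\<close>
  (\<open>comp_at_eq_bullet_padded\<close>).
\<close>

section \<open>Generating the symmetric group\<close>

definition cyclic_shift :: "nat \<Rightarrow> nat \<Rightarrow> nat" where
  "cyclic_shift n i = (if i < n then Suc i mod n else i)"

lemma funpow_cyclic_shift:
  "(cyclic_shift n ^^ k) i = (if i < n then (i + k) mod n else i)"
  by (induction k) (auto simp: cyclic_shift_def mod_Suc_eq)

lemma funpow_cyclic_shift_self: "cyclic_shift n ^^ n = id"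
  by (rule ext) (simp add: funpow_cyclic_shift)

lemma cyclic_shift_comp_funpow:
  assumes "0 < n"
  shows "cyclic_shift n \<circ> cyclic_shift n ^^ (n - 1) = id"
    and "cyclic_shift n ^^ (n - 1) \<circ> cyclic_shift n = id"
proof -
  obtain m where m: "n = Suc m"
    using assms by (cases n) auto
  have "cyclic_shift n ^^ Suc m = id"
    using funpow_cyclic_shift_self[of n] by (simp only: m)
  then show "cyclic_shift n \<circ> cyclic_shift n ^^ (n - 1) = id"
    and "cyclic_shift n ^^ (n - 1) \<circ> cyclic_shift n = id"
    by (simp_all only: m diff_Suc_1 flip: funpow.simps(2) funpow_Suc_right)
qed

lemma bij_cyclic_shift: "bij (cyclic_shift n)"
proof (cases "n = 0")
  case True
  then have "cyclic_shift n = id"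
    by (auto simp: cyclic_shift_def)
  then show ?thesis by simp
next
  case False
  then show ?thesis
    using cyclic_shift_comp_funpow[of n] by (intro o_bij) auto
qed

lemma cyclic_shift_permutes: "cyclic_shift n permutes {..<n}"
  unfolding permutes_def
  using bij_cyclic_shift[of n] by (auto simp: cyclic_shift_def bij_iff)

text \<open>
  Conjugating by the cycle moves the transposition of the first two points to any pair of
  neighbours; conjugating further by neighbour transpositions gives all transpositions.
\<close>

lemma permutes_generated_by_swap_and_cycle:
  assumes one: "id \<in> G"
    and comp: "\<And>p q. p \<in> G \<Longrightarrow> q \<in> G \<Longrightarrow> p \<circ> q \<in> G"
    and swap: "2 \<le> n \<Longrightarrow> transpose 0 1 \<in> G"
    and cycle: "cyclic_shift n \<in> G"
    and p: "p permutes {..<n}"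
  shows "p \<in> G"
proof -
  have funpow: "cyclic_shift n ^^ k \<in> G" for k
    by (induction k) (simp_all only: funpow.simps one comp cycle)
  have neighbours: "transpose i (Suc i) \<in> G" if "Suc i < n" for i
    using that
  proof (induction i)
    case 0
    then show ?case using swap by simp
  next
    case (Suc i)
    let ?c = "cyclic_shift n"
    have inv: "inv ?c (Suc i) = i" "inv ?c (Suc (Suc i)) = Suc i"
      using Suc.prems by (auto intro!: inv_f_eq bij_is_inj bij_cyclic_shift simp: cyclic_shift_def)
    have "transpose (Suc i) (Suc (Suc i)) = transpose (Suc i) (Suc (Suc i)) \<circ> (?c \<circ> ?c ^^ (n - 1))"
      using Suc.prems by (subst cyclic_shift_comp_funpow) auto
    also have "\<dots> = ?c \<circ> transpose i (Suc i) \<circ> ?c ^^ (n - 1)"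
      by (simp only: o_assoc transpose_comp_eq[OF bij_cyclic_shift] inv)
    finally show ?case
      using Suc by (simp only: Suc_lessD comp cycle funpow)
  qed
  have ascending: "transpose a (Suc (a + d)) \<in> G" if "Suc (a + d) < n" for a d
    using that
  proof (induction d)
    case 0
    then show ?case using neighbours by simp
  next
    case (Suc d)
    let ?b = "Suc (a + d)"
    have "transpose a (Suc ?b) = transpose a ?b \<circ> transpose ?b (Suc ?b) \<circ> transpose a ?b"
      by (rule transpose_comp_triple[symmetric]) auto
    moreover have "transpose a ?b \<in> G" "transpose ?b (Suc ?b) \<in> G"
      using Suc neighbours[of ?b] by auto
    ultimately show ?case
      by (simp only: add_Suc_right comp)
  qed
  have transposition: "transpose a b \<in> G" if "a < n" "b < n" "a \<noteq> b" for a b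
    using that
  proof (induction a b rule: linorder_wlog)
    case (le a b)
    then show ?case
      using ascending[of a "b - Suc a"] by simp
  next
    case (sym a b)
    then show ?case by (simp add: transpose_commute)
  qed
  from p finite_lessThan show ?thesis
    by (induction rule: permutes_induct)
      (simp_all only: lessThan_iff simp_thms one comp transposition)
qed

section \<open>Rearranging the inputs of a map\<close>

lemma nlists_takeI: "x \<in> nlists n A \<Longrightarrow> m \<le> n \<Longrightarrow> take m x \<in> nlists m A"
  unfolding nlists_def by (auto dest: in_set_takeD)

lemma nlists_dropI: "x \<in> nlists n A \<Longrightarrow> n = m + k \<Longrightarrow> drop m x \<in> nlists k A"
  unfolding nlists_def by (auto dest: in_set_dropD)

lemma nlists_permute_listI:
  "x \<in> nlists n A \<Longrightarrow> p permutes {..<n} \<Longrightarrow> permute_list p x \<in> nlists n A"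
  unfolding nlists_def by auto

lemma maps_arity: "f \<in> maps A \<Longrightarrow> 1 \<le> arity f"
  and maps_coarity: "f \<in> maps A \<Longrightarrow> 1 \<le> coarity f"
  and maps_app: "f \<in> maps A \<Longrightarrow> x \<in> nlists (arity f) A \<Longrightarrow> app f x \<in> nlists (coarity f) A"
  and maps_undefined: "f \<in> maps A \<Longrightarrow> x \<notin> nlists (arity f) A \<Longrightarrow> app f x = undefined"
  unfolding maps_def maps_of_def by (auto simp: PiE_iff extensional_def)

definition reindex :: "'a set \<Rightarrow> (nat \<Rightarrow> nat) \<Rightarrow> 'a mapping \<Rightarrow> 'a mapping" where
  "reindex A p f =
     Mapping (arity f) (coarity f) (\<lambda>x\<in>nlists (arity f) A. app f (permute_list p x))"

lemma arity_reindex [simp]: "arity (reindex A p f) = arity f"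
  and coarity_reindex [simp]: "coarity (reindex A p f) = coarity f"
  by (simp_all add: reindex_def)

lemma reindex_id: "f \<in> maps A \<Longrightarrow> reindex A id f = f"
  by (rule mapping.expand) (auto simp: reindex_def fun_eq_iff maps_undefined)

lemma reindex_comp:
  assumes "p permutes {..<arity f}" "q permutes {..<arity f}"
  shows "reindex A (p \<circ> q) f = reindex A p (reindex A q f)"
  using assms
  by (auto simp: reindex_def fun_eq_iff nlists_permute_listI permute_list_compose)

lemma tau_eq_reindex:
  assumes "2 \<le> arity f"
  shows "tau A f = reindex A (transpose 0 1) f"
proof -
  have "x ! 1 # x ! 0 # drop 2 x = permute_list (transpose 0 1) x" if "x \<in> nlists (arity f) A" for x
    using assms that
    by (intro nth_equalityI)
      (auto simp: permute_list_def nth_Cons transpose_def numeral_2_eq_2 split: nat.splits)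
  then show ?thesis
    using assms by (auto simp: tau_def reindex_def fun_eq_iff)
qed

lemma zeta_eq_reindex:
  assumes "f \<in> maps A"
  shows "zeta A f = reindex A (cyclic_shift (arity f)) f"
proof (cases "arity f = 1")
  case True
  then have "cyclic_shift (arity f) = id"
    by (auto simp: cyclic_shift_def)
  then show ?thesis
    using True assms by (simp add: zeta_def reindex_id)
next
  case False
  have "tl x @ [hd x] = permute_list (cyclic_shift (arity f)) x" if "x \<in> nlists (arity f) A" for x
  proof (rule nth_equalityI)
    show "length (tl x @ [hd x]) = length (permute_list (cyclic_shift (arity f)) x)"
      using that maps_arity[OF assms] by simp
    fix i assume "i < length (tl x @ [hd x])"
    then have "i < arity f"
      using that maps_arity[OF assms] by simp
    moreover have "x \<noteq> []"
      using nlistsE_length[OF that] maps_arity[OF assms] by auto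
    ultimately show "(tl x @ [hd x]) ! i = permute_list (cyclic_shift (arity f)) x ! i"
      using that
      by (cases "Suc i = arity f")
        (auto simp: permute_list_def cyclic_shift_def nth_append nth_tl hd_conv_nth)
  qed
  then show ?thesis
    using False by (auto simp: zeta_def reindex_def fun_eq_iff)
qed

text \<open>
  The admissible permutations are closed under composition because admissibility refers to all
  members of \<open>F\<close> of the given arity: the second rearrangement is applied to a map that is
  itself a rearranged member of \<open>F\<close>.
\<close>

lemma closed_reindex:
  assumes F: "F \<subseteq> maps A" and tau: "closed_unary F (tau A)" and zeta: "closed_unary F (zeta A)"
    and f: "f \<in> F" and p: "p permutes {..<arity f}"
  shows "reindex A p f \<in> F"
proof -
  define G where
    "G = {q. q permutes {..<arity f} \<and> (\<forall>g\<in>F. arity g = arity f \<longrightarrow> reindex A q g \<in> F)}"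
  have "p \<in> G"
  proof (rule permutes_generated_by_swap_and_cycle[OF _ _ _ _ p])
    show "id \<in> G"
      using F by (auto simp: G_def permutes_id reindex_id subset_iff)
    show "q \<circ> r \<in> G" if "q \<in> G" "r \<in> G" for q r
      using that by (auto simp: G_def permutes_compose reindex_comp)
    show "transpose 0 1 \<in> G" if "2 \<le> arity f"
    proof -
      have "reindex A (transpose 0 1) g \<in> F" if "g \<in> F" "arity g = arity f" for g
        using that \<open>2 \<le> arity f\<close> tau tau_eq_reindex[of g A] unfolding closed_unary_def by metis
      then show ?thesis
        using that unfolding G_def by (auto intro!: permutes_swap_id)
    qed
    show "cyclic_shift (arity f) \<in> G"
      using zeta F zeta_eq_reindex[of _ A]
      by (fastforce simp: G_def closed_unary_def cyclic_shift_permutes subset_iff)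
  qed
  with f show ?thesis
    by (simp add: G_def)
qed

section \<open>Identities and the maps of permutations\<close>

definition id_maps :: "'a set \<Rightarrow> nat \<Rightarrow> 'a mapping" where
  "id_maps A n = Mapping n n (\<lambda>x\<in>nlists n A. x)"

lemma arity_id_maps [simp]: "arity (id_maps A n) = n"
  and coarity_id_maps [simp]: "coarity (id_maps A n) = n"
  by (simp_all add: id_maps_def)

lemma id_maps_Suc: "id_maps A (Suc n) = oplus A (id_map A) (id_maps A n)"
  by (auto simp: id_maps_def oplus_def id_map_def fun_eq_iff nlists_takeI nlists_dropI)

lemma closed_id_maps:
  assumes "closed_nullary F (id_map A)" "closed_binary F (oplus A)" "1 \<le> n"
  shows "id_maps A n \<in> F"
  using assms(3)
proof (induction n rule: dec_induct)
  case base
  then show ?case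
    using assms(1) by (simp add: closed_nullary_def id_map_def id_maps_def)
next
  case (step n)
  then show ?case
    using assms(1,2) by (simp add: id_maps_Suc closed_nullary_def closed_binary_def)
qed

text \<open>
  List positions start at 0 while \<open>\<pi>\<^sub>\<alpha>\<close> is indexed from 1 and uses \<open>\<alpha>\<^sup>-\<^sup>1\<close>; conjugating
  with the successor function translates between the two conventions.
\<close>

lemma perm_map_eq_reindex:
  assumes "\<And>i. i < n \<Longrightarrow> inv \<alpha> (Suc i) = Suc (p i)" and "p permutes {..<n}"
  shows "perm_map A n \<alpha> = reindex A p (id_maps A n)"
proof -
  have "map (\<lambda>i. x ! (inv \<alpha> i - 1)) [1..<Suc n] = permute_list p x" if "x \<in> nlists n A" for x
    using that assms(1) by (intro nth_equalityI) (auto simp: permute_list_def simp del: upt_Suc)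
  then show ?thesis
    using assms(2)
    by (auto simp: perm_map_def reindex_def id_maps_def fun_eq_iff nlists_permute_listI
        simp del: upt_Suc)
qed

lemma bij_betw_Suc_lessThan: "bij_betw Suc {..<n} {1..n}"
  by (simp add: bij_betw_def lessThan_atLeast0 atLeastLessThanSuc_atLeastAtMost)

lemma perm_map_is_reindex:
  assumes "\<alpha> permutes {1..n}"
  obtains p where "p permutes {..<n}" "perm_map A n \<alpha> = reindex A p (id_maps A n)"
proof -
  define p where "p = map_permutation {1..n} (\<lambda>i. i - 1) (inv \<alpha>)"
  have inv: "inv \<alpha> permutes {1..n}"
    using assms by (rule permutes_inv)
  have bij: "bij_betw (\<lambda>i. i - 1) {1..n} {..<n}"
    by (rule bij_betw_byWitness[where f' = Suc]) auto
  have p: "p permutes {..<n}"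
    unfolding p_def using bij inv by (rule map_permutation_permutes)
  have "inv \<alpha> (Suc i) = Suc (p i)" if "i < n" for i
  proof -
    have "inv \<alpha> (Suc i) \<in> {1..n}"
      using permutes_in_image[OF inv, of "Suc i"] that by simp
    moreover have "p (Suc i - 1) = inv \<alpha> (Suc i) - 1"
      unfolding p_def using bij that
      by (intro map_permutation_apply) (auto simp: bij_betw_def)
    ultimately show ?thesis by simp
  qed
  then show thesis
    using p perm_map_eq_reindex that by blast
qed

lemma reindex_is_perm_map:
  assumes "p permutes {..<n}"
  obtains \<alpha> where "\<alpha> permutes {1..n}" "perm_map A n \<alpha> = reindex A p (id_maps A n)"
proof -
  define \<beta> where "\<beta> = map_permutation {..<n} Suc p"
  have \<beta>: "\<beta> permutes {1..n}"
    unfolding \<beta>_def using bij_betw_Suc_lessThan assms by (rule map_permutation_permutes)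
  have "inv (inv \<beta>) (Suc i) = Suc (p i)" if "i < n" for i
    using that permutes_inv_inv[OF \<beta>] by (simp add: \<beta>_def map_permutation_apply)
  then show thesis
    using that permutes_inv[OF \<beta>] perm_map_eq_reindex assms by blast
qed

text \<open>
  Feeding \<open>f\<close> all outputs of a rearranged identity rearranges the inputs of \<open>f\<close>; since \<open>f\<close> has no
  further inputs and the identity no further outputs, arity and co-arity are those of \<open>f\<close>.
\<close>

lemma comp_at_reindexed_id:
  assumes "f \<in> maps A" "p permutes {..<arity f}"
  shows "comp_at A (arity f) f (reindex A p (id_maps A (arity f))) = Some (reindex A p f)"
  using assms maps_arity[OF assms(1)]
  by (auto simp: comp_at_def reindex_def id_maps_def fun_eq_iff nlists_permute_listI)

lemma closed_reindex_of_perm_maps: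
  assumes F: "F \<subseteq> maps A"
    and perms: "\<And>n \<alpha>. 1 \<le> n \<Longrightarrow> \<alpha> permutes {1..n} \<Longrightarrow> perm_map A n \<alpha> \<in> F"
    and comp: "\<And>k. 1 \<le> k \<Longrightarrow> closed_partial_binary F (comp_at A k)"
    and f: "f \<in> F" and p: "p permutes {..<arity f}"
  shows "reindex A p f \<in> F"
proof -
  have f': "f \<in> maps A" and arity: "1 \<le> arity f"
    using F f maps_arity by auto
  obtain \<alpha> where "\<alpha> permutes {1..arity f}"
    and "perm_map A (arity f) \<alpha> = reindex A p (id_maps A (arity f))"
    using reindex_is_perm_map[OF p] by blast
  then have "reindex A p (id_maps A (arity f)) \<in> F"
    using perms arity by metis
  then show ?thesis
    using comp[OF arity] f comp_at_reindexed_id[OF f' p]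
    unfolding closed_partial_binary_def by blast
qed

section \<open>Partial composition from total composition\<close>

text \<open>
  Used with \<open>permute_list\<close>, which looks up the old position of each entry, this exchanges the
  blocks of lengths \<open>b\<close> and \<open>c\<close> that follow a prefix of length \<open>a\<close>.
\<close>

definition block_swap :: "nat \<Rightarrow> nat \<Rightarrow> nat \<Rightarrow> nat \<Rightarrow> nat" where
  "block_swap a b c i =
     (if i < a then i else if i < a + c then i + b else if i < a + c + b then i - c else i)"

lemma block_swap_permutes: "block_swap a b c permutes {..<a + b + c}"
proof (rule bij_imp_permutes)
  show "bij_betw (block_swap a b c) {..<a + b + c} {..<a + b + c}"
    by (rule bij_betw_byWitness[where f' = "block_swap a c b"]) (auto simp: block_swap_def)
qed (auto simp: block_swap_def)

lemma permute_list_block_swap: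
  "permute_list (block_swap (length u) (length v) (length w)) (u @ v @ w) = u @ w @ v"
proof (rule nth_equalityI)
  fix i assume "i < length (permute_list (block_swap (length u) (length v) (length w)) (u @ v @ w))"
  then have i: "i < length u + length v + length w"
    by simp
  consider "i < length u" | "length u \<le> i" "i < length u + length w" | "length u + length w \<le> i"
    by linarith
  then show "permute_list (block_swap (length u) (length v) (length w)) (u @ v @ w) ! i
      = (u @ w @ v) ! i"
  proof cases
    case 1
    then show ?thesis by (simp add: permute_list_def block_swap_def nth_append)
  next
    case 2
    then obtain j where "i = length u + j" "j < length w"
      using le_Suc_ex by fastforce
    then show ?thesis by (simp add: permute_list_def block_swap_def nth_append)
  next
    case 3
    then obtain j where "i = length u + length w + j" "j < length v"
      using i le_Suc_ex by fastforce
    then show ?thesis by (simp add: permute_list_def block_swap_def nth_append)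
  qed
qed simp

text \<open>
  The outputs \<open>y\<^sub>k\<^sub>+\<^sub>1, \<dots>, y\<^sub>t\<close> of \<open>g\<close> travel along the identity wires added to \<open>f\<close>.  The padded map
  reads \<open>y\<^sub>1, \<dots>, y\<^sub>k\<close>, then the free inputs of \<open>f\<close>, then the wires; exchanging the last two blocks
  makes \<open>y\<^sub>1, \<dots>, y\<^sub>t\<close> its first \<open>t\<close> inputs, and as it has at least \<open>t\<close> inputs, \<open>\<bullet>\<close> composes along
  all of them.
\<close>

lemma comp_at_eq_bullet_padded:
  assumes f: "f \<in> maps A" and g: "g \<in> maps A"
    and k: "1 \<le> k" "k \<le> arity f" "k < coarity g"
  defines "d \<equiv> coarity g - k"
  shows "comp_at A k f g =
    Some (bullet A (reindex A (block_swap k d (arity f - k)) (oplus A f (id_maps A d))) g)"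
proof -
  define h where "h = oplus A f (id_maps A d)"
  define p where "p = block_swap k d (arity f - k)"
  have h: "arity h = arity f + d" "coarity h = coarity f + d"
    by (simp_all add: h_def oplus_def)
  have p: "p permutes {..<arity f + d}"
    using block_swap_permutes[of k d "arity f - k"] k by (simp add: p_def algebra_simps)
  have t: "coarity g = k + d"
    using k by (simp add: d_def)
  have min: "min (arity f + d) (coarity g) = coarity g"
    using k t by simp
  have padded: "app (reindex A p h) (y @ z) = app f (take k y @ z) @ drop k y"
    if y: "y \<in> nlists (k + d) A" and z: "z \<in> nlists (arity f - k) A" for y z
  proof -
    have "permute_list p (take k y @ drop k y @ z) = take k y @ z @ drop k y"
      using permute_list_block_swap[of "take k y" "drop k y" z] y z by (simp add: p_def)
    then have perm: "permute_list p (y @ z) = (take k y @ z) @ drop k y"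
      by (simp flip: append_assoc)
    have yz: "y @ z \<in> nlists (arity f + d) A"
      using nlists_appendI[OF y z] k by (simp add: algebra_simps)
    have "take k y @ z \<in> nlists (k + (arity f - k)) A"
      using y z by (intro nlists_appendI nlists_takeI) auto
    then have fst: "take k y @ z \<in> nlists (arity f) A"
      using k by simp
    have snd: "drop k y \<in> nlists d A"
      using y by (rule nlists_dropI) simp
    have "app h ((take k y @ z) @ drop k y) = app f (take k y @ z) @ drop k y"
      using nlists_appendI[OF fst snd] nlistsE_length[OF fst] snd k(2)
      by (simp add: h_def oplus_def id_maps_def del: append_assoc)
    then show ?thesis
      using yz by (simp add: reindex_def h perm del: append_assoc)
  qed
  have "comp_at A k f g = comp_at A (coarity g) (reindex A p h) g"
  proof -
    have args: "app g (take (arity g) x) \<in> nlists (k + d) A"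
      "drop (arity g) x \<in> nlists (arity f - k) A"
      if "x \<in> nlists (arity f + arity g - k) A" for x
      using maps_app[OF g nlists_takeI[OF that]] nlists_dropI[OF that] k t by auto
    have arity: "arity f + d + arity g - coarity g = arity f + arity g - k"
      and coarity: "coarity f + d + coarity g - coarity g = coarity f + coarity g - k"
      using k t by simp_all
    show ?thesis
      using k t min padded[OF args] nlistsE_length[OF args(1)]
      by (auto simp: comp_at_def h arity coarity Let_def restrict_def fun_eq_iff)
  qed
  also have "\<dots> = Some (bullet A (reindex A p h) g)"
    using k t min by (auto simp: bullet_def h comp_at_def)
  finally show ?thesis
    by (simp add: h_def p_def)
qed

lemma comp_at_eq_bullet:
  assumes "1 \<le> k" "k \<le> arity f" "k = coarity g"
  shows "comp_at A k f g = Some (bullet A f g)"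
  using assms by (auto simp: bullet_def comp_at_def)

lemma closed_bullet:
  assumes F: "F \<subseteq> maps A" and comp: "\<And>k. 1 \<le> k \<Longrightarrow> closed_partial_binary F (comp_at A k)"
  shows "closed_binary F (bullet A)"
  unfolding closed_binary_def
proof (intro ballI)
  fix f g assume fg: "f \<in> F" "g \<in> F"
  define k where "k = min (arity f) (coarity g)"
  have k: "1 \<le> k"
    using fg F maps_arity maps_coarity by (fastforce simp: k_def)
  then have "comp_at A k f g = Some (bullet A f g)"
    by (simp add: bullet_def comp_at_def k_def)
  then show "bullet A f g \<in> F"
    using comp[OF k] fg unfolding closed_partial_binary_def by blast
qed

lemma closed_comp_at:
  assumes F: "F \<subseteq> maps A" and one: "closed_nullary F (id_map A)"
    and plus: "closed_binary F (oplus A)"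
    and tau: "closed_unary F (tau A)" and zeta: "closed_unary F (zeta A)"
    and bullet: "closed_binary F (bullet A)"
  shows "closed_partial_binary F (comp_at A k)"
  unfolding closed_partial_binary_def
proof (intro ballI allI impI)
  fix f g h assume fg: "f \<in> F" "g \<in> F" and h: "comp_at A k f g = Some h"
  then have k: "1 \<le> k" "k \<le> arity f" "k \<le> coarity g"
    by (auto simp: comp_at_def split: if_splits)
  show "h \<in> F"
    \<comment> \<open>Padding with \<open>coarity g - k\<close> wires presupposes at least one wire, as no member of \<open>F\<close> has arity 0.\<close>
  proof (cases "k = coarity g")
    case True
    then show ?thesis
      using comp_at_eq_bullet[OF k(1,2) True, of A] h fg bullet
      unfolding closed_binary_def by auto
  next
    case False
    define d where "d = coarity g - k"
    define e where "e = oplus A f (id_maps A d)"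
    have "id_maps A d \<in> F"
      using one plus False k by (intro closed_id_maps) (auto simp: d_def)
    then have e: "e \<in> F"
      using plus fg by (simp add: e_def closed_binary_def)
    have "block_swap k d (arity f - k) permutes {..<arity e}"
      using block_swap_permutes[of k d "arity f - k"] k
      by (simp add: e_def oplus_def algebra_simps)
    then have "reindex A (block_swap k d (arity f - k)) e \<in> F"
      using closed_reindex[OF F tau zeta e] by blast
    then have "bullet A (reindex A (block_swap k d (arity f - k)) e) g \<in> F"
      using bullet fg by (simp add: closed_binary_def)
    moreover have "f \<in> maps A" "g \<in> maps A"
      using fg F by auto
    ultimately show ?thesis
      using comp_at_eq_bullet_padded[of f A g k] h k False by (simp add: d_def e_def)
  qed
qed

section \<open>The characterisation\<close>

lemma closed_perm_map:
  assumes "F \<subseteq> maps A" "closed_nullary F (id_map A)" "closed_binary F (oplus A)"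
    and "closed_unary F (tau A)" "closed_unary F (zeta A)"
    and "1 \<le> n" "\<alpha> permutes {1..n}"
  shows "perm_map A n \<alpha> \<in> F"
proof -
  obtain p where "p permutes {..<n}" "perm_map A n \<alpha> = reindex A p (id_maps A n)"
    using perm_map_is_reindex[OF assms(7)] by blast
  then show ?thesis
    using closed_reindex[OF assms(1,4,5) closed_id_maps[OF assms(2,3,6)]] by simp
qed

lemma closed_operations_of_perm_maps:
  assumes F: "F \<subseteq> maps A"
    and perms: "\<And>n \<alpha>. 1 \<le> n \<Longrightarrow> \<alpha> permutes {1..n} \<Longrightarrow> perm_map A n \<alpha> \<in> F"
    and comp: "\<And>k. 1 \<le> k \<Longrightarrow> closed_partial_binary F (comp_at A k)"
  shows "closed_nullary F (id_map A)" "closed_unary F (tau A)" "closed_unary F (zeta A)"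
proof -
  have "perm_map A 1 id = id_map A"
  proof -
    have "[x ! 0] = x" if "x \<in> nlists 1 A" for x
      using that by (auto simp: in_nlists_Suc_iff)
    then show ?thesis
      by (auto simp: perm_map_def id_map_def fun_eq_iff)
  qed
  then show "closed_nullary F (id_map A)"
    using perms[of 1 id] by (simp add: closed_nullary_def permutes_id)
  note reindex = closed_reindex_of_perm_maps[OF F perms comp]
  show "closed_unary F (tau A)"
    unfolding closed_unary_def
  proof
    fix f assume f: "f \<in> F"
    show "tau A f \<in> F"
    proof (cases "arity f = 1")
      case True
      then show ?thesis using f by (simp add: tau_def)
    next
      case False
      then have "2 \<le> arity f"
        using maps_arity f F by fastforce
      then show ?thesis
        using reindex[OF _ _ _ f, of "transpose 0 1"]
        by (simp add: tau_eq_reindex permutes_swap_id)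
    qed
  qed
  show "closed_unary F (zeta A)"
    unfolding closed_unary_def
    using reindex cyclic_shift_permutes F by (auto simp: zeta_eq_reindex subset_iff)
qed

theorem theorem2p13:
  fixes A :: "'a set" and F :: "'a mapping set"
  assumes "A \<noteq> {}" and "F \<subseteq> maps A"
  shows
    "(toffoli_algebra A F \<longleftrightarrow>
        closed_nullary F (id_map A) \<and> closed_binary F (oplus A) \<and>
        closed_unary F (tau A) \<and> closed_unary F (zeta A) \<and>
        (\<forall>k\<ge>1. closed_partial_binary F (comp_at A k)))
     \<and>
     (toffoli_algebra A F \<longleftrightarrow>
        closed_binary F (oplus A) \<and>
        (\<forall>n\<ge>1. \<forall>\<alpha>. \<alpha> permutes {1..n} \<longrightarrow> closed_nullary F (perm_map A n \<alpha>)) \<and>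
        (\<forall>k\<ge>1. closed_partial_binary F (comp_at A k)))
     \<and>
     (toffoli_algebra A F \<longleftrightarrow>
        closed_nullary F (id_map A) \<and> closed_binary F (oplus A) \<and>
        closed_unary F (tau A) \<and> closed_unary F (zeta A) \<and>
        closed_binary F (bullet A))"
proof -
  let ?T = "toffoli_algebra A F"
  have F: "F \<subseteq> maps A" by fact
  have perms: "closed_nullary F (perm_map A n \<alpha>)"
    if ?T "1 \<le> n" "\<alpha> permutes {1..n}" for n \<alpha>
    using that closed_perm_map[OF F]
    by (auto simp: toffoli_algebra_def closed_nullary_def[of F "perm_map A n \<alpha>"])
  have of_perms: ?T
    if "closed_binary F (oplus A)"
      "\<forall>n\<ge>1. \<forall>\<alpha>. \<alpha> permutes {1..n} \<longrightarrow> closed_nullary F (perm_map A n \<alpha>)"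
      "\<forall>k\<ge>1. closed_partial_binary F (comp_at A k)"
    using that closed_operations_of_perm_maps[OF F] F
    by (simp add: toffoli_algebra_def closed_nullary_def[of F "perm_map A _ _"])
  have bullet: "closed_binary F (bullet A)" if ?T
    using that closed_bullet[OF F] by (simp add: toffoli_algebra_def)
  have of_bullet: ?T
    if "closed_nullary F (id_map A)" "closed_binary F (oplus A)"
      "closed_unary F (tau A)" "closed_unary F (zeta A)" "closed_binary F (bullet A)"
    using that closed_comp_at[OF F] F by (simp add: toffoli_algebra_def)
  show ?thesis
    by (intro conjI iffI) (use F perms of_perms bullet of_bullet in \<open>auto simp: toffoli_algebra_def\<close>)
qed

end
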